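(* Let $r\geq 1$ be an integer and let $j\in\{0,1,2,3\}$. Then $p_r,\ p_{r+1},\ p_{3r+j}$ form a regular sequence in $\mathbb{C}[x,y,z]$ if and only if $6\mid r(r+1)(3r+j)$.
   Context: For an integer $m\geq 1$, $p_m=x^m+y^m+z^m\in\mathbb{C}[x,y,z]$ denotes the $m$-th power sum in three variables. *)

theory Defs
  imports Complex_Main "HOL-Computational_Algebra.Polynomial"
begin

text \<open>In a commutative ring, regarded as a module over itself via multiplication, the span of
  a set is the ideal generated by it.\<close>

definition ideal_generated :: "'a::comm_ring_1 set \<Rightarrow> 'a set" where
  "ideal_generated S = module.span (*) S"

text \<open>The first condition says that multiplication by \<open>fs ! i\<close> is injective on the quotient of
  the ring by the ideal generated by the preceding elements; the second one says that the
  quotient by the whole sequence is not the zero ring.\<close>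

definition regular_sequence :: "'a::comm_ring_1 list \<Rightarrow> bool" where
  "regular_sequence fs \<longleftrightarrow>
     (\<forall>i < length fs. \<forall>g. fs ! i * g \<in> ideal_generated (set (take i fs)) \<longrightarrow>
                          g \<in> ideal_generated (set (take i fs))) \<and>
     ideal_generated (set fs) \<noteq> UNIV"

text \<open>The ring \<open>\<complex>[x,y,z]\<close> is the iterated polynomial ring \<open>\<complex>[x][y][z]\<close>: the outermost
  polynomial variable is \<open>z\<close>, the innermost one is \<open>x\<close>.\<close>

type_synonym cpoly3 = "complex poly poly poly"

definition var_x :: cpoly3 where "var_x = [:[:[:0, 1:]:]:]"
definition var_y :: cpoly3 where "var_y = [:[:0, 1:]:]"
definition var_z :: cpoly3 where "var_z = [:0, 1:]"

definition power_sum :: "nat \<Rightarrow> cpoly3" where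
  "power_sum m = var_x ^ m + var_y ^ m + var_z ^ m"

end

theory Submission
  imports Defs "HOL-Computational_Algebra.Computational_Algebra" "HOL-Computational_Algebra.Field_as_Ring"
begin

text \<open>A common zero of \<open>p\<^sub>r\<close> and \<open>p\<^sub>r\<^sub>+\<^sub>1\<close> satisfies \<open>x\<^sup>r = l (y - z)\<close>, \<open>y\<^sup>r = l (z - x)\<close>, \<open>z\<^sup>r = l (x - y)\<close>.
  Hence \<open>p\<^sub>3\<^sub>r\<^sub>+\<^sub>j\<close> takes there the value \<open>l\<^sup>3 (x - y) (y - z) (z - x)\<close> times \<open>3\<close>, \<open>e\<^sub>1\<close>, \<open>e\<^sub>2\<close>, \<open>3 e\<^sub>3\<close>
  for \<open>j = 0, 1, 2, 3\<close>. If \<open>e\<^sub>1 = 0\<close>, comparing moduli in the triangle \<open>x, y, z\<close> with centroid 0 shows that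
  it is equilateral. If \<open>e\<^sub>2 = 0\<close>, the same holds for the triangle of the inverses, after a finer estimate.
  So the only nontrivial common zeros are the multiples of \<open>(1, \<omega>, \<omega>\<^sup>2)\<close> up to order, which are excluded
  exactly by the divisibility condition.

  If there is no nontrivial common zero, some power of \<open>z\<close> lies in the ideal of the three power sums; as
  \<open>z\<close> is a nonzerodivisor modulo \<open>(p\<^sub>r, p\<^sub>r\<^sub>+\<^sub>1)\<close>, so is \<open>p\<^sub>3\<^sub>r\<^sub>+\<^sub>j\<close>. Conversely, near the line through
  \<open>(1, \<omega>, \<omega>\<^sup>2)\<close> the ideal \<open>(p\<^sub>r, p\<^sub>r\<^sub>+\<^sub>1)\<close> is the full ideal \<open>(e\<^sub>1, e\<^sub>2)\<close> of the line, so that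
  \<open>D p\<^sub>3\<^sub>r\<^sub>+\<^sub>j \<in> (p\<^sub>r, p\<^sub>r\<^sub>+\<^sub>1)\<close> for some \<open>D\<close> not vanishing on the line.\<close>

subsection \<open>Common zeros of the power sums\<close>

text \<open>Parallelogram law for \<open>v\<close> and \<open>w\<close>, with
  \<open>v + w = - u\<close>.\<close>

lemma cmod_power2_diff_of_sum_zero:
  fixes u v w :: complex
  assumes "u + v + w = 0"
  shows "(cmod (v - w))\<^sup>2 = 2 * (cmod v)\<^sup>2 + 2 * (cmod w)\<^sup>2 - (cmod u)\<^sup>2"
proof -
  have u: "u = - (v + w)"
    using assms by (simp add: algebra_simps eq_neg_iff_add_eq_0)
  show ?thesis
    unfolding u norm_minus_cancel cmod_power2 by (simp add: algebra_simps power2_eq_square)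
qed

text \<open>With a common squared modulus \<open>A\<close>, each conjugate is \<open>A\<close>
  divided by the number itself, so the conjugated sum times \<open>u * v * w\<close> is
  \<open>A\<close> times the second elementary symmetric polynomial.\<close>

lemma e2_zero_of_equal_cmod:
  fixes u v w :: complex
  assumes sum: "u + v + w = 0" and uv: "cmod u = cmod v" and uw: "cmod u = cmod w"
  shows "u * v + v * w + w * u = 0"
proof -
  define A where "A = complex_of_real ((cmod u)\<^sup>2)"
  have A: "u * cnj u = A" "v * cnj v = A" "w * cnj w = A"
    using uv uw complex_norm_square[of u] complex_norm_square[of v] complex_norm_square[of w]
    by (simp_all add: A_def)
  have "cnj u + cnj v + cnj w = 0"
    using arg_cong[OF sum, of cnj] by simp
  hence "u * v * w * (cnj u + cnj v + cnj w) = 0"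
    by simp
  hence "v * w * (u * cnj u) + u * w * (v * cnj v) + u * v * (w * cnj w) = 0"
    by (simp add: algebra_simps)
  hence "A * (u * v + v * w + w * u) = 0"
    unfolding A by (simp add: algebra_simps)
  moreover have "u * v + v * w + w * u = 0" if "A = 0"
    using that uv uw by (simp add: A_def)
  ultimately show ?thesis
    by auto
qed

text \<open>The three numbers are roots of \<open>t ^ 3 - x * y * z\<close>, so the power sum is
  three times a power of \<open>x * y * z\<close>.\<close>

lemma power_sum_zero_of_e1_e2_zero:
  fixes x y z :: complex
  assumes e1: "x + y + z = 0" and e2: "x * y + y * z + z * x = 0"
    and p: "x ^ n + y ^ n + z ^ n = 0" and n: "3 dvd n"
  shows "x * y * z = 0"
proof -
  obtain m where m: "n = 3 * m"
    using n by blast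
  have "x ^ 3 = x\<^sup>2 * (x + y + z) - x * (x * y + y * z + z * x) + x * y * z"
    "y ^ 3 = y\<^sup>2 * (x + y + z) - y * (x * y + y * z + z * x) + x * y * z"
    "z ^ 3 = z\<^sup>2 * (x + y + z) - z * (x * y + y * z + z * x) + x * y * z"
    by algebra+
  hence "x ^ 3 = x * y * z" "y ^ 3 = x * y * z" "z ^ 3 = x * y * z"
    using e1 e2 by simp_all
  hence "3 * (x * y * z) ^ m = 0"
    using p unfolding m power_mult by simp
  thus ?thesis
    by (cases "x * y * z = 0") simp_all
qed

text \<open>The quotient of the difference of powers by \<open>v - w\<close> is a sum of
  \<open>Suc n\<close> monomials of modulus \<open>R ^ n\<close>.\<close>

lemma cmod_power_diff_le:
  fixes v w :: complex
  assumes "cmod v = R" "cmod w = R"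
  shows "cmod (v ^ Suc n - w ^ Suc n) \<le> real (Suc n) * cmod (v - w) * R ^ n"
proof (induction n)
  case (Suc n)
  have "v ^ Suc (Suc n) - w ^ Suc (Suc n) = v * (v ^ Suc n - w ^ Suc n) + (v - w) * w ^ Suc n"
    by (simp add: algebra_simps)
  hence "cmod (v ^ Suc (Suc n) - w ^ Suc (Suc n))
      \<le> cmod (v * (v ^ Suc n - w ^ Suc n)) + cmod ((v - w) * w ^ Suc n)"
    by (metis norm_triangle_ineq)
  also have "\<dots> = R * cmod (v ^ Suc n - w ^ Suc n) + cmod (v - w) * R ^ Suc n"
    unfolding norm_mult norm_power assms ..
  also have "\<dots> \<le> R * (real (Suc n) * cmod (v - w) * R ^ n) + cmod (v - w) * R ^ Suc n"
    using Suc assms(1) by (intro add_right_mono mult_left_mono) auto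
  also have "\<dots> = real (Suc (Suc n)) * cmod (v - w) * R ^ Suc n"
    by (simp add: algebra_simps)
  finally show ?case .
qed simp

text \<open>The maximum is at \<open>n = 0\<close>: each step multiplies the expression by at most
  \<open>3 * q\<close>, which is at most 1.\<close>

lemma square_mult_power_le:
  fixes q :: real
  assumes "0 \<le> q" "q \<le> 1 / 3"
  shows "(real (n + 2))\<^sup>2 * q ^ (n + 1) \<le> 4 / 3"
proof (induction n)
  case (Suc n)
  have "(real (Suc n + 2))\<^sup>2 \<le> 3 * (real (n + 2))\<^sup>2"
    by (simp add: power2_eq_square algebra_simps)
  hence "(real (Suc n + 2))\<^sup>2 * q ^ (Suc n + 1) \<le> 3 * (real (n + 2))\<^sup>2 * (q ^ (n + 1) * q)"
    using assms by (intro mult_mono) (auto simp: mult.commute)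
  also have "\<dots> = (real (n + 2))\<^sup>2 * q ^ (n + 1) * (3 * q)"
    by simp
  also have "\<dots> \<le> (real (n + 2))\<^sup>2 * q ^ (n + 1) * 1"
    using assms by (intro mult_left_mono) auto
  finally show ?case
    using Suc by simp
qed (use assms in auto)

text \<open>Squaring \<open>side\<close> gives \<open>4 * q - 1 = q ^ s * (q + 2)\<close> for the
  ratio \<open>q\<close> of the squared moduli. Besides 1, this equation has a root between 1/4 and
  1, which is excluded by means of \<open>ps\<close>.\<close>

lemma equal_cmod_of_isosceles:
  fixes u v w :: complex
  assumes nz: "u \<noteq> 0" "v \<noteq> 0" and sum: "u + v + w = 0" and vw: "cmod v = cmod w"
    and s: "s \<ge> 2" and side: "cmod (u ^ s * (v - w)) = cmod (v ^ s * (w - u))"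
    and ps: "v ^ s * w ^ s + u ^ s * (v ^ s + w ^ s) = 0"
  shows "cmod u = cmod v"
proof -
  define A B where "A = (cmod u)\<^sup>2" and "B = (cmod v)\<^sup>2"
  define q where "q = B / A"
  have pos: "A > 0" "B > 0" "q > 0"
    using nz by (auto simp: A_def B_def q_def)
  have B: "B = q * A"
    using pos by (simp add: q_def)
  have Bw: "B = (cmod w)\<^sup>2"
    by (simp add: B_def vw)
  have sw: "v + w + u = 0"
    using sum by (simp add: algebra_simps)
  have d1: "(cmod (v - w))\<^sup>2 = 4 * B - A"
    using cmod_power2_diff_of_sum_zero[OF sum] Bw by (simp add: A_def B_def vw)
  have d2: "(cmod (w - u))\<^sup>2 = 2 * A + B"
    using cmod_power2_diff_of_sum_zero[OF sw] Bw by (simp add: A_def B_def vw)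
  have sq: "(cmod t ^ k)\<^sup>2 = ((cmod t)\<^sup>2) ^ k" for t k
    by (simp flip: power_mult add: mult.commute)
  have "A ^ s * (4 * B - A) = B ^ s * (2 * A + B)"
    using arg_cong[OF side, of "\<lambda>t. t\<^sup>2"]
    unfolding norm_mult norm_power power_mult_distrib sq d1 d2 by (simp add: A_def B_def)
  hence "A ^ Suc s * (4 * q - 1) = A ^ Suc s * (q ^ s * (q + 2))"
    unfolding B power_mult_distrib by (simp add: algebra_simps)
  hence q: "4 * q - 1 = q ^ s * (q + 2)"
    using pos by simp
  obtain n where n: "s = n + 2"
    using s by (metis add.commute le_Suc_ex)
  \<comment> \<open>The equation for \<open>s = 2\<close> factors; for general \<open>s\<close>,
    \<open>q ^ s\<close> is compared with the square of \<open>q\<close> on either side of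
    1.\<close>
  have fact: "q\<^sup>2 * (q + 2) - (4 * q - 1) = (q - 1) * (q\<^sup>2 + 3 * q - 1)"
    by (simp add: algebra_simps power2_eq_square)
  have "\<not> q > 1"
  proof
    assume "q > 1"
    hence "q\<^sup>2 * (q + 2) \<le> q ^ s * (q + 2)"
      using s by (intro mult_right_mono power_increasing) auto
    moreover have "(q - 1) * (q\<^sup>2 + 3 * q - 1) > 0"
      using \<open>q > 1\<close> zero_le_power2[of q] by (intro mult_pos_pos) linarith+
    ultimately show False
      using fact q by linarith
  qed
  moreover have "\<not> q < 1"
  \<comment> \<open>Both \<open>v\<^sup>s + w\<^sup>s\<close> (by \<open>ps\<close>) and \<open>v\<^sup>s - w\<^sup>s\<close> (as \<open>v\<close> is close to \<open>w\<close>) would be too small for the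
    parallelogram law.\<close>
  proof
    assume "q < 1"
    hence "q ^ s * (q + 2) \<le> q\<^sup>2 * (q + 2)"
      using s pos by (intro mult_right_mono power_decreasing) auto
    hence "(q - 1) * (q\<^sup>2 + 3 * q - 1) \<ge> 0"
      using fact q by linarith
    hence "q\<^sup>2 + 3 * q - 1 \<le> 0"
      using \<open>q < 1\<close> by (auto simp: zero_le_mult_iff)
    hence q3: "q \<le> 1 / 3"
      using zero_le_power2[of q] by linarith
    have "cmod (v ^ s - w ^ s) \<le> real s * cmod (v - w) * cmod v ^ (n + 1)"
      using cmod_power_diff_le[OF refl vw[symmetric], of "n + 1"] by (simp add: n)
    hence "(cmod (v ^ s - w ^ s))\<^sup>2 \<le> (real s * cmod (v - w) * cmod v ^ (n + 1))\<^sup>2"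
      by (intro power_mono) auto
    also have "\<dots> = (real s)\<^sup>2 * (4 * B - A) * B ^ (n + 1)"
      unfolding power_mult_distrib sq d1 by (simp add: B_def)
    also have "4 * B - A = A * (4 * q - 1)"
      by (simp add: B algebra_simps)
    also have "(real s)\<^sup>2 * (A * (4 * q - 1)) * B ^ (n + 1) = B ^ s * ((real s)\<^sup>2 * q ^ (n + 1) * (q + 2))"
      unfolding q unfolding n B by (simp add: algebra_simps)
    finally have minus: "(cmod (v ^ s - w ^ s))\<^sup>2 \<le> B ^ s * ((real s)\<^sup>2 * q ^ (n + 1) * (q + 2))" .
    have "u ^ s * (v ^ s + w ^ s) = - (v ^ s * w ^ s)"
      using ps by (simp add: eq_neg_iff_add_eq_0 add.commute)
    hence "cmod (u ^ s * (v ^ s + w ^ s)) = cmod (v ^ s * w ^ s)"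
      by (metis norm_minus_cancel)
    from arg_cong[OF this, of "\<lambda>t. t\<^sup>2"] have "A ^ s * (cmod (v ^ s + w ^ s))\<^sup>2 = B ^ s * B ^ s"
      unfolding norm_mult norm_power power_mult_distrib sq by (simp add: A_def B_def vw)
    also have "\<dots> = A ^ s * (B ^ s * q ^ s)"
      by (simp add: B power_mult_distrib)
    finally have plus: "(cmod (v ^ s + w ^ s))\<^sup>2 = B ^ s * q ^ s"
      using pos by simp
    have "(cmod (v ^ s + w ^ s))\<^sup>2 + (cmod (v ^ s - w ^ s))\<^sup>2 = 2 * (cmod (v ^ s))\<^sup>2 + 2 * (cmod (w ^ s))\<^sup>2"
      unfolding cmod_power2 by (simp add: algebra_simps power2_eq_square)
    also have "\<dots> = B ^ s * 4"
      unfolding norm_power sq by (simp add: B_def vw)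
    finally have "B ^ s * 4 \<le> B ^ s * (q ^ s + (real s)\<^sup>2 * q ^ (n + 1) * (q + 2))"
      using plus minus by (simp add: algebra_simps)
    hence "4 \<le> q ^ s + (real s)\<^sup>2 * q ^ (n + 1) * (q + 2)"
      using pos by simp
    also have "\<dots> \<le> q ^ 1 + 4 / 3 * (q + 2)"
      using square_mult_power_le[of q n] pos q3 \<open>q < 1\<close>
      by (intro add_mono mult_right_mono power_decreasing) (auto simp: n)
    \<comment> \<open>At \<open>q = 1 / 3\<close> the right-hand side is only 31/9.\<close>
    finally have "4 \<le> q + 4 / 3 * (q + 2)"
      by simp
    thus False
      using q3 by (simp add: field_simps)
  qed
  ultimately have "q = 1"
    by simp
  hence "A = B"
    using B by simp
  thus ?thesis
    by (simp add: A_def B_def)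
qed

text \<open>By Rolle, three equal values would give two positive critical points of
  \<open>t ^ s * (T - 3 * t)\<close>, but there is at most one.\<close>

lemma mult_power_not_three_equal_values:
  fixes a b c T :: real
  assumes "0 < a" "a < b" "b < c" "s > 0"
    and ab: "a ^ s * (T - 3 * a) = b ^ s * (T - 3 * b)"
    and bc: "b ^ s * (T - 3 * b) = c ^ s * (T - 3 * c)"
  shows False
proof -
  define g where "g = (\<lambda>t::real. t ^ s * (T - 3 * t))"
  define g' where "g' = (\<lambda>t::real. t ^ (s - 1) * (real s * T - 3 * (real s + 1) * t))"
  have der: "(g has_real_derivative g' t) (at t)" for t
  proof -
    obtain k where s: "s = Suc k"
      using \<open>s > 0\<close> by (cases s) auto
    show ?thesis
      unfolding g_def g'_def
      by (rule DERIV_cong[OF DERIV_mult[OF DERIV_pow DERIV_diff[OF DERIV_const DERIV_cmult[OF DERIV_ident]]]])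
        (simp add: s algebra_simps)
  qed
  have cont: "continuous_on X g" for X
    by (simp add: g_def continuous_intros)
  have crit: "\<exists>t. l < t \<and> t < h \<and> g' t = 0" if "l < h" "g l = g h" for l h
    \<comment> \<open>Rolle's theorem yields a derivative that vanishes as a linear map; evaluation
      at 1 recovers the number \<open>g' t\<close>.\<close>
    using Rolle_deriv[of l h g "\<lambda>t d. g' t * d"] that der cont
    by (auto simp: has_field_derivative_def fun_eq_iff dest: spec[where x = 1])
  obtain t1 t2 where t: "a < t1" "t1 < b" "g' t1 = 0" "b < t2" "t2 < c" "g' t2 = 0"
    using crit[of a b] crit[of b c] assms by (auto simp: g_def)
  hence "real s * T = 3 * (real s + 1) * t1" "real s * T = 3 * (real s + 1) * t2"
    using assms by (auto simp: g'_def)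
  hence "t1 = t2"
    by simp
  with t show False
    by simp
qed

text \<open>Each squared side is \<open>T\<close> minus three times the squared modulus of the
  opposite vertex. So \<open>t ^ s * (T - 3 * t)\<close> agrees at the three squared moduli, two of
  which must coincide, and the isosceles case applies.\<close>

lemma e2_zero_of_power_times_difference_eq:
  fixes u v w :: complex
  assumes nz: "u \<noteq> 0" "v \<noteq> 0" "w \<noteq> 0" and sum: "u + v + w = 0" and s: "s \<ge> 2"
    and k: "u ^ s * (v - w) = k" "v ^ s * (w - u) = k" "w ^ s * (u - v) = k"
    and ps: "u ^ s * v ^ s + v ^ s * w ^ s + w ^ s * u ^ s = 0"
  shows "u * v + v * w + w * u = 0"
proof -
  define T where "T = 2 * ((cmod u)\<^sup>2 + (cmod v)\<^sup>2 + (cmod w)\<^sup>2)"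
  have sums: "v + w + u = 0" "w + u + v = 0"
    using sum by (simp_all add: algebra_simps)
  have sq: "(cmod t ^ n)\<^sup>2 = ((cmod t)\<^sup>2) ^ n" for t n
    by (simp flip: power_mult add: mult.commute)
  have val: "((cmod a)\<^sup>2) ^ s * (T - 3 * (cmod a)\<^sup>2) = (cmod k)\<^sup>2"
    if "a ^ s * (b - c) = k" "a + b + c = 0" "T = 2 * ((cmod a)\<^sup>2 + (cmod b)\<^sup>2 + (cmod c)\<^sup>2)" for a b c
    using cmod_power2_diff_of_sum_zero[OF that(2)] that(3)
    unfolding that(1)[symmetric] norm_mult norm_power power_mult_distrib sq by simp
  define g where "g = (\<lambda>t::real. t ^ s * (T - 3 * t))"
  have vals: "g ((cmod u)\<^sup>2) = (cmod k)\<^sup>2" "g ((cmod v)\<^sup>2) = (cmod k)\<^sup>2" "g ((cmod w)\<^sup>2) = (cmod k)\<^sup>2"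
    unfolding g_def using val[OF k(1) sum] val[OF k(2) sums(1)] val[OF k(3) sums(2)]
    by (simp_all add: T_def)
  have no: False if "0 < a" "a < b" "b < c" "g a = (cmod k)\<^sup>2" "g b = (cmod k)\<^sup>2" "g c = (cmod k)\<^sup>2" for a b c
    using mult_power_not_three_equal_values[of a b c s T] that s by (simp add: g_def)
  have pos: "0 < (cmod u)\<^sup>2" "0 < (cmod v)\<^sup>2" "0 < (cmod w)\<^sup>2"
    using nz by auto
  have "(cmod u)\<^sup>2 = (cmod v)\<^sup>2 \<or> (cmod v)\<^sup>2 = (cmod w)\<^sup>2 \<or> (cmod w)\<^sup>2 = (cmod u)\<^sup>2"
    using no vals pos by (metis linorder_neqE_linordered_idom)
  hence "cmod u = cmod v \<or> cmod v = cmod w \<or> cmod w = cmod u"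
    by simp
  hence "cmod u = cmod v \<and> cmod u = cmod w"
  proof (elim disjE)
    assume h: "cmod v = cmod w"
    have "v ^ s * w ^ s + u ^ s * (v ^ s + w ^ s) = 0"
      using ps by (simp add: algebra_simps)
    with h show ?thesis
      using equal_cmod_of_isosceles[of u v w s] nz sum s k by simp
  next
    assume h: "cmod w = cmod u"
    have "w ^ s * u ^ s + v ^ s * (w ^ s + u ^ s) = 0"
      using ps by (simp add: algebra_simps)
    with h show ?thesis
      using equal_cmod_of_isosceles[of v w u s] nz sums s k by simp
  next
    assume h: "cmod u = cmod v"
    have "u ^ s * v ^ s + w ^ s * (u ^ s + v ^ s) = 0"
      using ps by (simp add: algebra_simps)
    with h show ?thesis
      using equal_cmod_of_isosceles[of w u v s] nz sums s k by simp
  qed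
  thus ?thesis
    using e2_zero_of_equal_cmod sum by blast
qed

text \<open>In a triangle with centroid 0, a vertex farther from 0 faces a shorter side, whereas
  \<open>pw\<close> makes it face a longer one. Hence all moduli agree.\<close>

lemma e2_zero_of_power_eq_difference:
  fixes x y z :: complex
  assumes e1: "x + y + z = 0" and r: "r \<ge> 1" and l: "l \<noteq> 0"
    and pw: "x ^ r = l * (y - z)" "y ^ r = l * (z - x)" "z ^ r = l * (x - y)"
  shows "x * y + y * z + z * x = 0"
proof -
  have le: "cmod b \<le> cmod a"
    if e: "a + b + c = 0" and a: "a ^ r = l * (b - c)" and b: "b ^ r = l * (c - a)" for a b c
  proof (rule ccontr)
    assume "\<not> ?thesis"
    hence lt: "cmod a < cmod b"
      by simp
    have "b + c + a = 0"
      using e by (simp add: algebra_simps)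
    from cmod_power2_diff_of_sum_zero[OF this] cmod_power2_diff_of_sum_zero[OF e]
    have "(cmod (b - c))\<^sup>2 - (cmod (c - a))\<^sup>2 = 3 * (cmod b)\<^sup>2 - 3 * (cmod a)\<^sup>2"
      by simp
    moreover have "(cmod a)\<^sup>2 < (cmod b)\<^sup>2"
      using lt by (intro power_strict_mono) auto
    ultimately have "(cmod (c - a))\<^sup>2 < (cmod (b - c))\<^sup>2"
      by simp
    hence "cmod (c - a) < cmod (b - c)"
      by (simp add: power_less_imp_less_base)
    hence "cmod (b ^ r) < cmod (a ^ r)"
      unfolding a b norm_mult using l by simp
    moreover have "cmod a ^ r < cmod b ^ r"
      using lt r by (intro power_strict_mono) auto
    ultimately show False
      by (simp add: norm_power)
  qed
  have "cmod y \<le> cmod x" "cmod z \<le> cmod y" "cmod x \<le> cmod z"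
    using le[of x y z] le[of y z x] le[of z x y] e1 pw by (simp_all add: algebra_simps)
  thus ?thesis
    by (intro e2_zero_of_equal_cmod e1) linarith+
qed

text \<open>Passing to inverses exchanges the roles of the first two elementary symmetric
  polynomials and raises the exponent to \<open>Suc r\<close>. The power sum of exponent
  \<open>Suc r\<close> vanishes because \<open>x * (y - z) + y * (z - x) + z * (x - y) = 0\<close>;
  this provides \<open>ps\<close>.\<close>

lemma e1_zero_of_power_eq_difference:
  fixes x y z :: complex
  assumes nz: "x \<noteq> 0" "y \<noteq> 0" "z \<noteq> 0" and e2: "x * y + y * z + z * x = 0"
    and r: "r \<ge> 1" and l: "l \<noteq> 0"
    and pw: "x ^ r = l * (y - z)" "y ^ r = l * (z - x)" "z ^ r = l * (x - y)"
  shows "x + y + z = 0"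
proof -
  define k where "k = - (1 / (l * (x * y * z)))"
  have inv: "inverse a ^ Suc r * (inverse b - inverse c) = - (1 / (l * (a * b * c)))"
    if "a \<noteq> 0" "b \<noteq> 0" "c \<noteq> 0" "a ^ r = l * (b - c)" for a b c
  proof -
    have "b - c \<noteq> 0"
      using that by auto
    have "inverse a ^ Suc r * (inverse b - inverse c) = - (b - c) / (a ^ r * (a * b * c))"
      using that(1-3) by (simp add: field_simps)
    also have "\<dots> = - (1 / (l * (a * b * c)))"
      unfolding that(4) using that(1-3) \<open>b - c \<noteq> 0\<close> l by (simp add: field_simps)
    finally show ?thesis .
  qed
  have ks: "inverse x ^ Suc r * (inverse y - inverse z) = k"
    "inverse y ^ Suc r * (inverse z - inverse x) = k"
    "inverse z ^ Suc r * (inverse x - inverse y) = k"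
    using inv[OF nz pw(1)] inv[OF nz(2,3,1) pw(2)] inv[OF nz(3,1,2) pw(3)]
    by (simp_all only: k_def ac_simps)
  have sum_inverse: "inverse a + inverse b + inverse c = (a * b + b * c + c * a) * inverse (a * b * c)"
    and prod_inverse: "inverse a * inverse b + inverse b * inverse c + inverse c * inverse a
      = (a + b + c) * inverse (a * b * c)"
    if "a \<noteq> 0" "b \<noteq> 0" "c \<noteq> 0" for a b c :: complex
  proof -
    have "a * inverse a = 1" "b * inverse b = 1" "c * inverse c = 1"
      using that by simp_all
    thus "inverse a + inverse b + inverse c = (a * b + b * c + c * a) * inverse (a * b * c)"
      "inverse a * inverse b + inverse b * inverse c + inverse c * inverse a
        = (a + b + c) * inverse (a * b * c)"
      unfolding inverse_mult_distrib by algebra+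
  qed
  have sum: "inverse x + inverse y + inverse z = 0"
    unfolding sum_inverse[OF nz] e2 by simp
  have p1: "x ^ Suc r + y ^ Suc r + z ^ Suc r = 0"
    by (simp add: pw algebra_simps)
  have nzs: "x ^ Suc r \<noteq> 0" "y ^ Suc r \<noteq> 0" "z ^ Suc r \<noteq> 0"
    using nz by simp_all
  have ps: "inverse x ^ Suc r * inverse y ^ Suc r + inverse y ^ Suc r * inverse z ^ Suc r
      + inverse z ^ Suc r * inverse x ^ Suc r = 0"
    unfolding power_inverse prod_inverse[OF nzs] p1 by simp
  have inz: "inverse x \<noteq> 0" "inverse y \<noteq> 0" "inverse z \<noteq> 0"
    using nz by simp_all
  have "Suc r \<ge> 2"
    using r by simp
  from e2_zero_of_power_times_difference_eq[OF inz sum this ks ps]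
  have "(x + y + z) * inverse (x * y * z) = 0"
    unfolding prod_inverse[OF nz] .
  thus ?thesis
    using nz by simp
qed

section \<open>Common zeros with equal or vanishing coordinates, and the general case\<close>

lemma common_zero_of_two_equal:
  fixes x z :: complex
  assumes "2 * x ^ r + z ^ r = 0" "2 * x ^ (r + 1) + z ^ (r + 1) = 0" "r \<ge> 1"
  shows "x = 0" "z = 0"
proof -
  have "z ^ r * (z - x) = 2 * x ^ (r + 1) + z ^ (r + 1) - x * (2 * x ^ r + z ^ r)"
    by (simp add: algebra_simps)
  hence "z ^ r * (z - x) = 0"
    using assms by simp
  hence "z = 0 \<or> z = x"
    by auto
  hence "x = 0 \<and> z = 0"
    using assms by auto
  thus "x = 0" "z = 0"
    by auto
qed

lemma common_zero_of_one_zero: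
  fixes y z :: complex
  assumes "y ^ r + z ^ r = 0" "y ^ (r + 1) + z ^ (r + 1) = 0" "r \<ge> 1"
  shows "y = 0" "z = 0"
proof -
  have "z ^ r * (z - y) = y ^ (r + 1) + z ^ (r + 1) - y * (y ^ r + z ^ r)"
    by (simp add: algebra_simps)
  hence "z ^ r * (z - y) = 0"
    using assms by simp
  hence "z = 0 \<or> z = y"
    by auto
  hence "y = 0 \<and> z = 0"
    using assms by auto
  thus "y = 0" "z = 0"
    by auto
qed

lemma common_zero_trivial:
  fixes x y z :: complex
  assumes r: "r \<ge> 1" and j: "j \<in> {0, 1, 2, 3}"
    and div: "6 dvd r * (r + 1) * (3 * r + j)"
    and p1: "x ^ r + y ^ r + z ^ r = 0" and p2: "x ^ (r + 1) + y ^ (r + 1) + z ^ (r + 1) = 0"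
    and p3: "x ^ (3 * r + j) + y ^ (3 * r + j) + z ^ (3 * r + j) = 0"
  shows "z = 0"
proof (rule ccontr)
  assume z: "z \<noteq> 0"
  have x: "x \<noteq> 0" and y: "y \<noteq> 0"
    using common_zero_of_one_zero(2)[of y r z] common_zero_of_one_zero(2)[of x r z] p1 p2 r z
    by (auto simp: power_0_left)
  have neq: "x \<noteq> y" "y \<noteq> z" "z \<noteq> x"
    using common_zero_of_two_equal[of x r z] common_zero_of_two_equal[of y r x]
      common_zero_of_two_equal[of z r y] p1 p2 r z by (auto simp: ac_simps)
  \<comment> \<open>\<open>p1\<close> and \<open>p2\<close> are linear in the \<open>r\<close>-th
    powers, with coefficient rows \<open>(1, 1, 1)\<close> and \<open>(x, y, z)\<close>; their
    solutions are the multiples of the cross product of these rows.\<close>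
  define l where "l = x ^ r / (y - z)"
  have l: "l \<noteq> 0"
    using neq x by (simp add: l_def)
  have px: "x ^ r = l * (y - z)"
    using neq by (simp add: l_def)
  have "(y - z) * (y ^ r - l * (z - x))
      = x ^ (r + 1) + y ^ (r + 1) + z ^ (r + 1) - z * (x ^ r + y ^ r + z ^ r)
        + (z - x) * (x ^ r - l * (y - z))"
    by (simp add: algebra_simps)
  hence "(y - z) * (y ^ r - l * (z - x)) = 0"
    using p1 p2 px by simp
  hence py: "y ^ r = l * (z - x)"
    using neq by simp
  have pz: "z ^ r = l * (x - y)"
    using p1 unfolding px py by (simp add: algebra_simps add_eq_0_iff)
  define V where "V = (x - y) * (y - z) * (z - x)"
  have V: "V \<noteq> 0"
    using neq by (simp add: V_def)
  have "l ^ 3 * (x ^ j * (y - z) ^ 3 + y ^ j * (z - x) ^ 3 + z ^ j * (x - y) ^ 3) = 0"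
    using p3 unfolding power_add mult.commute[of 3 r] power_mult px py pz power_mult_distrib
    by (simp only: distrib_left ac_simps)
  hence s: "x ^ j * (y - z) ^ 3 + y ^ j * (z - x) ^ 3 + z ^ j * (x - y) ^ 3 = 0"
    using l by simp
  \<comment> \<open>Here 3 divides \<open>r\<close> or \<open>r + 1\<close>, so one of the first two
    power sums cannot vanish at a nonzero multiple of a permutation of the three cube roots of
    unity.\<close>
  have no: False if "x + y + z = 0" "x * y + y * z + z * x = 0" "\<not> 3 dvd 3 * r + j"
  proof -
    have "prime (3::nat)"
      by simp
    moreover have "3 dvd r * (r + 1) * (3 * r + j)"
      using div by (rule dvd_trans[rotated]) simp
    ultimately have "3 dvd r \<or> 3 dvd r + 1"
      using that(3) by (metis prime_dvd_mult_iff)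
    hence "x * y * z = 0"
      using power_sum_zero_of_e1_e2_zero[OF that(1,2)] p1 p2 by blast
    thus False
      using x y z by simp
  qed
  consider "j = 0" | "j = 1" | "j = 2" | "j = 3"
    using j by auto
  thus False
  proof cases
    case 1
    have "3 * V = 0"
      using s unfolding V_def 1 power_0 power_one_right by algebra
    thus ?thesis
      using V by simp
  next
    case 2
    have "V * (x + y + z) = 0"
      using s unfolding V_def 2 power_0 power_one_right by algebra
    hence e1: "x + y + z = 0"
      using V by simp
    have "\<not> 3 dvd 3 * r + j"
      unfolding 2 by presburger
    with no e1 e2_zero_of_power_eq_difference[OF e1 r l px py pz] show ?thesis
      by blast
  next
    case 3
    have "V * (x * y + y * z + z * x) = 0"
      using s unfolding V_def 3 power_0 power_one_right by algebra
    hence e2: "x * y + y * z + z * x = 0"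
      using V by simp
    have "\<not> 3 dvd 3 * r + j"
      unfolding 3 by presburger
    with no e2 e1_zero_of_power_eq_difference[OF x y z e2 r l px py pz] show ?thesis
      by blast
  next
    case 4
    have "3 * (x * y * z) * V = 0"
      using s unfolding V_def 4 power_0 power_one_right by algebra
    thus ?thesis
      using V x y z by simp
  qed
qed

subsection \<open>Ideals and regular sequences\<close>

lemma module_mult: "module ((*) :: 'a \<Rightarrow> 'a \<Rightarrow> 'a :: comm_ring_1)"
  by unfold_locales (simp_all add: algebra_simps)

lemma ideal_generated_empty: "ideal_generated {} = {0}"
  unfolding ideal_generated_def by (rule module.span_empty[OF module_mult])

lemma ideal_generated_insert:
  "ideal_generated (insert a S) = {g. \<exists>k. g - k * a \<in> ideal_generated S}"
  unfolding ideal_generated_def by (rule module.span_insert[OF module_mult])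

lemma ideal_generated_superset: "a \<in> S \<Longrightarrow> a \<in> ideal_generated S"
  unfolding ideal_generated_def by (rule module.span_base[OF module_mult])

lemma ideal_generated_add:
  "g \<in> ideal_generated S \<Longrightarrow> h \<in> ideal_generated S \<Longrightarrow> g + h \<in> ideal_generated S"
  unfolding ideal_generated_def by (rule module.span_add[OF module_mult])

lemma ideal_generated_mult: "g \<in> ideal_generated S \<Longrightarrow> c * g \<in> ideal_generated S"
  unfolding ideal_generated_def by (rule module.span_scale[OF module_mult])

lemma ideal_generated_diff:
  "g \<in> ideal_generated S \<Longrightarrow> h \<in> ideal_generated S \<Longrightarrow> g - h \<in> ideal_generated S"
  unfolding ideal_generated_def by (rule module.span_diff[OF module_mult])

lemma ideal_generated_singleton: "g \<in> ideal_generated {a} \<longleftrightarrow> a dvd g"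
  by (auto simp: ideal_generated_insert ideal_generated_empty dvd_def mult.commute)

lemma ideal_generated_two: "g \<in> ideal_generated {a, b} \<longleftrightarrow> (\<exists>k l. g = k * a + l * b)"
  by (auto simp: ideal_generated_insert ideal_generated_empty algebra_simps)

lemma ideal_generated_three:
  "g \<in> ideal_generated {a, b, c} \<longleftrightarrow> (\<exists>k l m. g = k * a + l * b + m * c)"
  by (auto simp: ideal_generated_insert ideal_generated_empty algebra_simps)

lemma regular_sequence_three:
  "regular_sequence [a, b, c] \<longleftrightarrow>
     (\<forall>g. a * g = 0 \<longrightarrow> g = 0) \<and> (\<forall>g. a dvd b * g \<longrightarrow> a dvd g) \<and>
     (\<forall>g. c * g \<in> ideal_generated {a, b} \<longrightarrow> g \<in> ideal_generated {a, b}) \<and>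
     ideal_generated {a, b, c} \<noteq> UNIV"
proof -
  have "(\<forall>i < length [a, b, c]. P i) \<longleftrightarrow> P 0 \<and> P 1 \<and> P 2" for P
    by (auto simp: numeral_2_eq_2 numeral_3_eq_3 less_Suc_eq)
  thus ?thesis
    unfolding regular_sequence_def
    by (simp add: ideal_generated_empty ideal_generated_singleton numeral_2_eq_2)
qed

text \<open>The coefficients do not form a field, but pseudo-division by a monic \<open>p\<close> is
  true division. Its remainder times \<open>c\<close> is a multiple of \<open>p\<close> of too small
  a degree, hence zero.\<close>

lemma monic_dvd_const_mult:
  fixes p g :: "'a :: idom poly"
  assumes monic: "lead_coeff p = 1" and c: "c \<noteq> 0" and dvd: "p dvd [:c:] * g"
  shows "p dvd g"
proof -
  have p: "p \<noteq> 0"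
    using monic by auto
  obtain k where k: "[:c:] * g = p * k"
    using dvd by blast
  obtain Q S where QS: "pseudo_divmod g p = (Q, S)"
    by fastforce
  have g: "g = p * Q + S"
    using pseudo_divmod(1)[OF p QS] monic by simp
  have S: "S = 0 \<or> degree S < degree p"
    by (rule pseudo_divmod(2)[OF p QS])
  have eq: "smult c S = p * (k - smult c Q)"
    using k unfolding g by (simp add: algebra_simps smult_add_right)
  have "S = 0"
  proof (rule ccontr)
    assume "S \<noteq> 0"
    hence "k - smult c Q \<noteq> 0"
      using eq c by auto
    hence "degree (smult c S) = degree p + degree (k - smult c Q)"
      unfolding eq using p by (simp add: degree_mult_eq)
    thus False
      using S \<open>S \<noteq> 0\<close> c by simp
  qed
  thus ?thesis
    using g by simp
qed

subsection \<open>Regularity in the absence of common zeros\<close>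

definition const3 :: "complex \<Rightarrow> cpoly3" where "const3 c = [:[:[:c:]:]:]"

definition eval3 :: "complex \<Rightarrow> complex \<Rightarrow> complex \<Rightarrow> cpoly3 \<Rightarrow> complex" where
  "eval3 a b c f = poly (poly (poly f [:[:c:]:]) [:b:]) a"

lemma eval3_simps [simp]:
  "eval3 a b c (f + g) = eval3 a b c f + eval3 a b c g"
  "eval3 a b c (f - g) = eval3 a b c f - eval3 a b c g"
  "eval3 a b c (f * g) = eval3 a b c f * eval3 a b c g"
  "eval3 a b c (- f) = - eval3 a b c f"
  "eval3 a b c (f ^ n) = eval3 a b c f ^ n"
  "eval3 a b c 0 = 0" "eval3 a b c 1 = 1" "eval3 a b c (numeral k) = numeral k"
  "eval3 a b c var_x = a" "eval3 a b c var_y = b" "eval3 a b c var_z = c"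
  by (simp_all add: eval3_def var_x_def var_y_def var_z_def poly_power)

lemma eval3_power_sum: "eval3 a b c (power_sum n) = a ^ n + b ^ n + c ^ n"
  by (simp add: power_sum_def)

text \<open>Homogenization; coefficients of \<open>p\<close> beyond \<open>d\<close> are dropped.\<close>

definition form :: "nat \<Rightarrow> complex poly \<Rightarrow> cpoly3" where
  "form d p = (\<Sum>i\<le>d. const3 (coeff p i) * var_y ^ i * var_z ^ (d - i))"

lemma const3_simps: "const3 (a + b) = const3 a + const3 b" "const3 (a * b) = const3 a * const3 b"
  "const3 0 = 0" "const3 1 = 1"
  by (simp_all add: const3_def one_pCons)

lemma form_pCons: "form (Suc d) (pCons a p) = const3 a * var_z ^ Suc d + var_y * form d p"
  unfolding form_def by (subst sum.atMost_Suc_shift) (simp add: sum_distrib_left ac_simps)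

lemma form_0: "form 0 p = const3 (coeff p 0)"
  by (simp add: form_def)

lemma form_add: "form d (p + q) = form d p + form d q"
  by (simp add: form_def const3_simps sum.distrib algebra_simps)

lemma form_smult: "form d (smult a p) = const3 a * form d p"
  by (simp add: form_def const3_simps sum_distrib_left ac_simps)

lemma form_Suc:
  assumes "degree p \<le> d"
  shows "form (Suc d) p = var_z * form d p"
proof -
  have "form (Suc d) p = (\<Sum>i\<le>d. const3 (coeff p i) * var_y ^ i * var_z ^ (Suc d - i))"
    using assms by (simp add: form_def coeff_eq_0 const3_simps)
  also have "\<dots> = var_z * form d p"
    unfolding form_def sum_distrib_left by (intro sum.cong) (auto simp: Suc_diff_le)
  finally show ?thesis .
qed

lemma form_diff_add: "degree p \<le> d \<Longrightarrow> form (e + d) p = var_z ^ e * form d p"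
  by (induction e) (simp_all add: form_Suc mult.assoc)

text \<open>Induction along the Horner scheme \<open>p = a + y * p'\<close>; the degree bounds
  ensure that no coefficient is dropped.\<close>

lemma form_mult:
  assumes "degree p \<le> d" "degree q \<le> e"
  shows "form (d + e) (p * q) = form d p * form e q"
  using assms(1)
proof (induction d arbitrary: p)
  case 0
  then obtain a where "p = [:a:]"
    by (auto elim: degree_eq_zeroE)
  thus ?case
    by (simp add: form_smult form_0)
next
  case (Suc d)
  obtain a p' where p: "p = pCons a p'"
    by (cases p)
  have p': "degree p' \<le> d"
    using Suc.prems by (auto simp: p split: if_splits)
  have "form (Suc d + e) (p * q) = const3 a * form (Suc d + e) q + form (Suc (d + e)) (pCons 0 (p' * q))"
    by (simp add: p form_add form_smult)
  also have "\<dots> = const3 a * (var_z ^ Suc d * form e q) + var_y * (form d p' * form e q)"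
    unfolding form_diff_add[OF assms(2)] form_pCons Suc.IH[OF p'] by (simp add: const3_simps)
  also have "\<dots> = form (Suc d) p * form e q"
    by (simp add: p form_pCons algebra_simps)
  finally show ?case .
qed

lemma form_1: "form d 1 = var_z ^ d"
  using form_diff_add[of 1 0 d] by (simp add: form_0 const3_simps)

lemma form_power:
  assumes "degree p \<le> d"
  shows "form (d * n) (p ^ n) = form d p ^ n"
proof (induction n)
  case (Suc n)
  have "degree (p ^ n) \<le> d * n"
    using degree_power_le[of p n] mult_le_mono1[OF assms, of n] by linarith
  from form_mult[OF assms this] Suc show ?case
    by simp
qed (simp add: form_1)

lemma form_monom_1: "form d (monom 1 d + 1) = var_y ^ d + var_z ^ d"
proof -
  have "form d (monom 1 d) = (\<Sum>i\<in>{d}. const3 (coeff (monom 1 d) i) * var_y ^ i * var_z ^ (d - i))"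
    unfolding form_def by (rule sum.mono_neutral_right) (auto simp: const3_simps coeff_monom)
  thus ?thesis
    by (simp add: form_add form_1 const3_simps)
qed

text \<open>Over the complex numbers, having no common root means being coprime. A Bezout identity
  for 1, homogenized in a large enough degree, expresses a power of \<open>var_z\<close>.\<close>

lemma var_z_power_in_ideal_of_forms:
  assumes no_root: "\<And>t. \<not> (poly p t = 0 \<and> poly q t = 0)"
    and deg: "degree p \<le> d" "degree q \<le> e"
  shows "\<exists>N. var_z ^ N \<in> ideal_generated {form d p, form e q}"
proof -
  have "coprime p q"
  proof (rule coprimeI)
    fix c assume c: "c dvd p" "c dvd q"
    have "degree c = 0"
    proof (rule ccontr)
      assume "degree c \<noteq> 0"
      hence "\<not> constant (poly c)"
        by (simp add: constant_degree)
      then obtain t where "poly c t = 0"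
        using fundamental_theorem_of_algebra by blast
      thus False
        using c no_root[of t] by (auto elim!: dvdE)
    qed
    moreover have "c \<noteq> 0"
      using c no_root[of 0] by auto
    ultimately show "is_unit c"
      by (simp add: is_unit_iff_degree)
  qed
  then obtain a b where ab: "a * p + b * q = 1"
    using bezout_coefficients_fst_snd[of p q] by (auto simp: coprime_iff_gcd_eq_1)
  define N where "N = max (degree a) (degree b)"
  have "form (N + e + d) (a * p + b * q) = form (N + e) a * form d p + form (N + d) b * form e q"
    unfolding form_add using form_mult[of a "N + e" p d] form_mult[of b "N + d" q e] deg
    by (simp add: N_def ac_simps)
  hence "var_z ^ (N + e + d) = form (N + e) a * form d p + form (N + d) b * form e q"
    by (simp add: ab form_1)
  thus ?thesis
    unfolding ideal_generated_two by blast
qed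

text \<open>Since \<open>p\<^sub>r\<^sub>+\<^sub>1 - x p\<^sub>r = (y\<^sup>r\<^sup>+\<^sup>1 + z\<^sup>r\<^sup>+\<^sup>1) - x (y\<^sup>r + z\<^sup>r)\<close> is linear in \<open>x\<close>, the variable \<open>x\<close> can be
  eliminated without resultants.\<close>

lemma var_z_power_in_ideal:
  assumes no_zero: "\<And>a b :: complex. \<not> (a ^ r + b ^ r + 1 = 0 \<and> a ^ (r + 1) + b ^ (r + 1) + 1 = 0 \<and>
      a ^ m + b ^ m + 1 = 0)"
  shows "\<exists>N. var_z ^ N \<in> ideal_generated {power_sum r, power_sum (r + 1), power_sum m}"
proof -
  define I where "I = ideal_generated {power_sum r, power_sum (r + 1), power_sum m}"
  define P :: "nat \<Rightarrow> complex poly" where "P = (\<lambda>n. monom 1 n + 1)"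
  \<comment> \<open>Up to the factor \<open>P r ^ n\<close>, this is \<open>power_sum n\<close> at
    \<open>z = 1\<close> with \<open>P (r + 1) / P r\<close> substituted for
    \<open>x\<close>.\<close>
  define E where "E = (\<lambda>n. P r ^ n * P n + P (r + 1) ^ n)"
  define G where "G = (\<lambda>n. var_y ^ n + var_z ^ n)"
  have degP: "degree (P n) \<le> n" for n
    unfolding P_def by (intro degree_add_le) (auto simp: degree_monom_le)
  have degPn: "degree (P k ^ n) \<le> k * n" for k n
    using degree_power_le[of "P k" n] mult_le_mono1[OF degP, of k n] by linarith
  have formP: "form n (P n) = G n" for n
    unfolding P_def G_def by (rule form_monom_1)
  have degE: "degree (E n) \<le> (r + 1) * n" for n
  proof -
    have "degree (P r ^ n * P n) \<le> (r + 1) * n"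
      using degree_mult_le[of "P r ^ n" "P n"] degP[of n] degPn[of r n] by simp
    thus ?thesis
      unfolding E_def using degPn[of "r + 1" n] by (intro degree_add_le) auto
  qed
  have formE: "form ((r + 1) * n) (E n) = G r ^ n * G n + G (r + 1) ^ n" for n
  proof -
    have "form ((r + 1) * n) (P r ^ n * P n) = form (r * n + n) (P r ^ n * P n)"
      by (simp add: add.commute)
    also have "\<dots> = G r ^ n * G n"
      using form_mult[OF degPn[of r n] degP[of n]] form_power[OF degP[of r], of n] by (simp add: formP)
    finally show ?thesis
      unfolding E_def form_add using form_power[OF degP[of "r + 1"], of n] by (simp add: formP)
  qed
  \<comment> \<open>Modulo \<open>I\<close>, \<open>G r * var_x\<close> equals
    \<open>G (r + 1)\<close>; so do their \<open>n\<close>-th powers, and these turn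
    \<open>G r ^ n * power_sum n\<close> into the form of \<open>E n\<close>.\<close>
  have in_I: "form ((r + 1) * n) (E n) \<in> I" if "power_sum n \<in> I" for n
  proof -
    have "G (r + 1) - G r * var_x = power_sum (r + 1) - var_x * power_sum r"
      by (simp add: G_def power_sum_def algebra_simps)
    moreover have "\<dots> \<in> I"
      unfolding I_def by (intro ideal_generated_diff ideal_generated_mult ideal_generated_superset) auto
    ultimately have "G (r + 1) - G r * var_x \<in> I"
      by simp
    hence "(\<Sum>i<n. (G r * var_x) ^ (n - Suc i) * G (r + 1) ^ i) * (G (r + 1) - G r * var_x) \<in> I"
      unfolding I_def by (rule ideal_generated_mult)
    hence "G (r + 1) ^ n - (G r * var_x) ^ n \<in> I"
      by (subst power_diff_sumr2) (simp add: mult.commute)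
    hence "G r ^ n * power_sum n + (G (r + 1) ^ n - (G r * var_x) ^ n) \<in> I"
      using that unfolding I_def by (intro ideal_generated_add ideal_generated_mult)
    also have "G r ^ n * power_sum n + (G (r + 1) ^ n - (G r * var_x) ^ n) = form ((r + 1) * n) (E n)"
    proof -
      have "power_sum n = var_x ^ n + G n"
        by (simp add: G_def power_sum_def)
      thus ?thesis
        unfolding formE power_mult_distrib by (simp add: algebra_simps)
    qed
    finally show ?thesis .
  qed
  have Er: "form ((r + 1) * r) (E r) \<in> I" and Em: "form ((r + 1) * m) (E m) \<in> I"
    by (rule in_I; unfold I_def, rule ideal_generated_superset, simp)+
  \<comment> \<open>A common root \<open>t\<close> would lift to the common zero
    \<open>(a, t, 1)\<close>, where \<open>a\<close> solves the equation linear in \<open>x\<close>.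
    Its denominator is nonzero, since otherwise \<open>t ^ r\<close> and \<open>t ^ (r + 1)\<close>
    would both be -1, forcing \<open>t = 1\<close>.\<close>
  have root: "\<not> (poly (E r) t = 0 \<and> poly (E m) t = 0)" for t
  proof
    assume "poly (E r) t = 0 \<and> poly (E m) t = 0"
    hence t: "poly (E r) t = 0" "poly (E m) t = 0"
      by blast+
    have pP: "poly (P n) t = t ^ n + 1" for n
      by (simp add: P_def poly_monom)
    have e: "(t ^ r + 1) ^ n * (t ^ n + 1) + (t ^ (r + 1) + 1) ^ n = 0" if "poly (E n) t = 0" for n
      using that by (simp add: E_def pP)
    have nz: "t ^ r + 1 \<noteq> 0"
    proof
      assume 0: "t ^ r + 1 = 0"
      hence "(t ^ (r + 1) + 1) ^ r = 0"
        using e[OF t(1)] by simp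
      hence "t ^ (r + 1) + 1 = 0"
        by (simp only: power_eq_0_iff)
      moreover have "t ^ r = -1"
        using 0 by (simp add: eq_neg_iff_add_eq_0)
      ultimately have "t = 1"
        by simp
      thus False
        using 0 by simp
    qed
    define a where "a = (t ^ (r + 1) + 1) / (t ^ r + 1)"
    have a: "t ^ (r + 1) + 1 = (t ^ r + 1) * a"
      using nz by (simp add: a_def)
    have pz: "a ^ n + t ^ n + 1 = 0" if "poly (E n) t = 0" for n
    proof -
      have "(t ^ r + 1) ^ n * (a ^ n + t ^ n + 1) = 0"
        using e[OF that] unfolding a power_mult_distrib by (simp add: algebra_simps)
      thus ?thesis
        using nz by simp
    qed
    have "a ^ (r + 1) + t ^ (r + 1) + 1 = a * (a ^ r + t ^ r + 1)"
      using a by (simp add: algebra_simps)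
    thus False
      using no_zero[of a t] pz[OF t(1)] pz[OF t(2)] by simp
  qed
  obtain N k l where "var_z ^ N = k * form ((r + 1) * r) (E r) + l * form ((r + 1) * m) (E m)"
    using var_z_power_in_ideal_of_forms[OF root degE degE] unfolding ideal_generated_two by blast
  moreover have "\<dots> \<in> I"
    using Er Em unfolding I_def by (intro ideal_generated_add ideal_generated_mult)
  ultimately show ?thesis
    unfolding I_def by metis
qed

section \<open>Cancellation modulo one and two power sums\<close>

lemma lead_coeff_monom_add_const:
  fixes c :: "'a :: idom"
  assumes "n \<ge> 1"
  shows "lead_coeff (monom 1 n + [:c:]) = 1"
proof -
  have "degree (monom 1 n + [:c:]) = n"
    using assms by (subst degree_add_eq_left) (auto simp: degree_monom_eq)
  thus ?thesis
    using assms by (simp add: coeff_pCons split: nat.splits)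
qed

text \<open>A combination of \<open>F r\<close> and \<open>F (r + 1)\<close> equals
  \<open>2 * x ^ (2 * r)\<close>, which is constant in the outer variable \<open>y\<close>, while
  \<open>F r\<close> is monic in \<open>y\<close>.\<close>

lemma power_sum_two_dvd_cancel:
  fixes B :: "complex poly poly"
  defines "F \<equiv> \<lambda>n. [:[:0, 1:]:] ^ n + [:0, 1:] ^ n :: complex poly poly"
  assumes r: "r \<ge> 1" and dvd: "F r dvd F (r + 1) * B"
  shows "F r dvd B"
proof -
  define x y :: "complex poly poly" where "x = [:[:0, 1:]:]" and "y = [:0, 1:]"
  have F: "F n = x ^ n + y ^ n" for n
    by (simp add: F_def x_def y_def)
  have xn: "x ^ n = [:monom 1 n:]" for n
    by (simp add: x_def poly_const_pow monom_altdef)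
  have yn: "y ^ n = monom 1 n" for n
    by (simp add: y_def monom_altdef)
  obtain s where s: "x ^ r - y ^ r = (x - y) * s"
    using power_diff_sumr2 by blast
  have "x ^ r * (x - y) = F (r + 1) - y * F r"
    by (simp add: F algebra_simps)
  hence "x ^ r * (x ^ r - y ^ r) = s * (F (r + 1) - y * F r)"
    unfolding s by (simp add: ac_simps)
  moreover have "x ^ r * (2 * x ^ r) = x ^ r * (x ^ r - y ^ r) + x ^ r * F r"
    by (simp add: F algebra_simps)
  ultimately have eq: "x ^ r * (2 * x ^ r) = s * (F (r + 1) - y * F r) + x ^ r * F r"
    by (simp only:)
  have "x ^ r * (2 * x ^ r) * B = s * (F (r + 1) * B) + F r * ((x ^ r - s * y) * B)"
    unfolding eq by (simp add: algebra_simps)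
  hence "F r dvd x ^ r * (2 * x ^ r) * B"
    using dvd by (metis dvd_add dvd_mult dvd_triv_left)
  moreover have "x ^ r * (2 * x ^ r) = [:monom 2 (r + r):]"
    unfolding xn by (simp add: mult_monom numeral_poly smult_monom)
  moreover have "lead_coeff (F r) = 1"
    unfolding F xn yn add.commute[of "[:_:]"] using r by (rule lead_coeff_monom_add_const)
  ultimately show ?thesis
    using monic_dvd_const_mult[of "F r" "monom 2 (r + r)" B] by simp
qed

lemma power_sum_conv:
  "power_sum n = [:[:[:0, 1:]:] ^ n + [:0, 1:] ^ n:] + var_z ^ n"
  by (simp add: power_sum_def var_x_def var_y_def poly_const_pow)

lemma power_sum_monic: "n \<ge> 1 \<Longrightarrow> lead_coeff (power_sum n) = 1"
  unfolding power_sum_conv using lead_coeff_monom_add_const[of n "[:[:0, 1:]:] ^ n + [:0, 1:] ^ n"]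
  by (simp add: var_z_def monom_altdef add.commute)

text \<open>At \<open>z = 0\<close> the coefficients \<open>A\<close>, \<open>B\<close> form a
  syzygy of \<open>F r\<close> and \<open>F (r + 1)\<close>, hence by the bivariate cancellation a
  multiple of the Koszul syzygy. After subtracting its lift, both coefficients are divisible by
  \<open>var_z\<close>.\<close>

lemma var_z_nonzerodivisor:
  assumes r: "r \<ge> 1" and g: "var_z * g \<in> ideal_generated {power_sum r, power_sum (r + 1)}"
  shows "g \<in> ideal_generated {power_sum r, power_sum (r + 1)}"
proof -
  define F where "F = (\<lambda>n. [:[:0, 1:]:] ^ n + [:0, 1:] ^ n :: complex poly poly)"
  define f where "f = (power_sum :: nat \<Rightarrow> cpoly3)"
  have f0: "poly (f n) 0 = F n" if "n \<ge> 1" for n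
    using that by (simp add: f_def power_sum_conv F_def var_z_def poly_power power_0_left)
  have split0: "\<exists>q. p = [:poly p 0:] + var_z * q" for p :: cpoly3
    by (cases p) (auto simp: var_z_def)
  obtain A B where AB: "var_z * g = A * f r + B * f (r + 1)"
    using g unfolding ideal_generated_two f_def by blast
  have z0: "poly var_z (0 :: complex poly poly) = 0"
    by (simp add: var_z_def)
  have eq0: "poly A 0 * F r + poly B 0 * F (r + 1) = 0"
    using arg_cong[OF AB, of "\<lambda>p. poly p 0"] r by (simp add: f0 z0)
  have "F (r + 1) * poly B 0 = F r * (- poly A 0)"
    using eq0 by (simp add: algebra_simps eq_neg_iff_add_eq_0)
  hence "F r dvd F (r + 1) * poly B 0"
    by (metis dvd_triv_left)
  hence "F r dvd poly B 0"
    unfolding F_def by (rule power_sum_two_dvd_cancel[OF r])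
  then obtain k where k: "poly B 0 = F r * k"
    by blast
  have "F r \<noteq> 0"
  proof
    assume "F r = 0"
    hence "poly (poly (F r) 0) 1 = 0"
      by simp
    thus False
      using r by (simp add: F_def poly_power power_0_left)
  qed
  moreover have "F r * (poly A 0 + F (r + 1) * k) = 0"
    using eq0 unfolding k by (simp add: algebra_simps)
  ultimately have k': "poly A 0 = - (F (r + 1) * k)"
    by (simp add: eq_neg_iff_add_eq_0)
  obtain A' B' where A': "A + [:k:] * f (r + 1) = var_z * A'" and B': "B - [:k:] * f r = var_z * B'"
    using split0[of "A + [:k:] * f (r + 1)"] split0[of "B - [:k:] * f r"] r by (auto simp: f0 k k')
  have "var_z * g = (A + [:k:] * f (r + 1)) * f r + (B - [:k:] * f r) * f (r + 1)"
    unfolding AB by (simp add: algebra_simps)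
  hence "var_z * g = var_z * (A' * f r + B' * f (r + 1))"
    unfolding A' B' by (simp add: algebra_simps)
  hence "g = A' * f r + B' * f (r + 1)"
    by (simp add: var_z_def)
  thus ?thesis
    unfolding ideal_generated_two f_def by blast
qed

text \<open>Eliminating \<open>z\<close> from the two power sums leaves the nonzero element
  \<open>c\<close> of their ideal, free of \<open>z\<close>, while \<open>power_sum r\<close> is
  monic in \<open>z\<close>.\<close>

lemma power_sum_dvd_cancel:
  assumes r: "r \<ge> 1" and dvd: "power_sum r dvd power_sum (r + 1) * g"
  shows "power_sum r dvd g"
proof -
  define F where "F = (\<lambda>n. [:[:0, 1:]:] ^ n + [:0, 1:] ^ n :: complex poly poly)"
  define f where "f = (power_sum :: nat \<Rightarrow> cpoly3)"
  have f: "f n = [:F n:] + var_z ^ n" for n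
    by (simp add: f_def power_sum_conv F_def)
  define c where "c = F r ^ (r + 1) + F (r + 1) ^ r"
  define d where "d = [:F r:] * var_z"
  obtain s where s: "[:F (r + 1):] ^ r - d ^ r = ([:F (r + 1):] - d) * s"
    using power_diff_sumr2 by blast
  have lin: "[:F (r + 1):] - d = f (r + 1) - var_z * f r"
    by (simp add: f d_def algebra_simps)
  have "[:c:] = [:F r:] ^ r * f r + ([:F (r + 1):] ^ r - d ^ r)"
    unfolding c_def f d_def power_mult_distrib
    by (simp add: poly_const_pow algebra_simps flip: smult_power)
  hence c: "[:c:] = [:F r:] ^ r * f r + (f (r + 1) - var_z * f r) * s"
    unfolding s lin .
  have "[:c:] * g = f r * (([:F r:] ^ r - s * var_z) * g) + s * (f (r + 1) * g)"
    unfolding c by (simp add: algebra_simps)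
  moreover have "f r dvd s * (f (r + 1) * g)"
    using dvd unfolding f_def by (rule dvd_mult)
  ultimately have "f r dvd [:c:] * g"
    by (metis dvd_add dvd_triv_left)
  moreover have "c \<noteq> 0"
  proof
    assume "c = 0"
    hence "poly (poly c 0) 1 = 0"
      by simp
    thus False
      using r by (simp add: c_def F_def poly_power power_0_left)
  qed
  ultimately show ?thesis
    using monic_dvd_const_mult[OF power_sum_monic[OF r]] unfolding f_def by blast
qed

lemma regular_sequence_if_no_common_zero:
  assumes r: "r \<ge> 1" and m: "m \<ge> 1"
    and no_zero: "\<And>a b :: complex. \<not> (a ^ r + b ^ r + 1 = 0 \<and> a ^ (r + 1) + b ^ (r + 1) + 1 = 0 \<and>
      a ^ m + b ^ m + 1 = 0)"
  shows "regular_sequence [power_sum r, power_sum (r + 1), power_sum m]"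
  unfolding regular_sequence_three
proof (intro conjI allI impI)
  fix g assume "power_sum r * g = 0"
  moreover have "power_sum r \<noteq> 0"
    using power_sum_monic[OF r] by auto
  ultimately show "g = 0"
    by simp
next
  fix g assume "power_sum r dvd power_sum (r + 1) * g"
  thus "power_sum r dvd g"
    by (rule power_sum_dvd_cancel[OF r])
next
  define I where "I = ideal_generated {power_sum r, power_sum (r + 1)}"
  fix g assume g: "power_sum m * g \<in> ideal_generated {power_sum r, power_sum (r + 1)}"
  obtain N a b c where N: "var_z ^ N = a * power_sum r + b * power_sum (r + 1) + c * power_sum m"
    using var_z_power_in_ideal[OF no_zero] unfolding ideal_generated_three by blast
  have "var_z ^ N * g = (a * g) * power_sum r + (b * g) * power_sum (r + 1) + c * (power_sum m * g)"
    unfolding N by (simp add: algebra_simps)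
  moreover have "\<dots> \<in> I"
    unfolding I_def
    by (intro ideal_generated_add ideal_generated_mult g; rule ideal_generated_superset; simp)
  ultimately have "var_z ^ N * g \<in> I"
    by simp
  hence "g \<in> I"
  proof (induction N)
    case (Suc N)
    thus ?case
      using var_z_nonzerodivisor[OF r, of "var_z ^ N * g"] by (simp add: I_def mult.assoc)
  qed simp
  thus "g \<in> ideal_generated {power_sum r, power_sum (r + 1)}"
    by (simp add: I_def)
next
  \<comment> \<open>The ideal is proper because all its elements vanish at the origin.\<close>
  have "eval3 0 0 0 g = 0" if "g \<in> ideal_generated {power_sum r, power_sum (r + 1), power_sum m}" for g
    using that r m by (auto simp: ideal_generated_three eval3_power_sum power_0_left)
  from this[of 1] show "ideal_generated {power_sum r, power_sum (r + 1), power_sum m} \<noteq> UNIV"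
    by auto
qed

subsection \<open>Failure of regularity at the cube roots of unity\<close>

definition e1 :: cpoly3 where "e1 = var_x + var_y + var_z"
definition e2 :: cpoly3 where "e2 = var_x * var_y + var_y * var_z + var_z * var_x"
definition e3 :: cpoly3 where "e3 = var_x * var_y * var_z"

text \<open>Newton's recursion: each variable is a root of the cubic with coefficients
  \<open>e1\<close>, \<open>e2\<close>, \<open>e3\<close>.\<close>

lemma power_sum_rec:
  "power_sum (n + 3) = e1 * power_sum (n + 2) - e2 * power_sum (n + 1) + e3 * power_sum n"
  by (simp add: power_sum_def e1_def e2_def e3_def algebra_simps power_add numeral_2_eq_2 numeral_3_eq_3)

text \<open>The Jacobian of \<open>(p\<^sub>r, p\<^sub>r\<^sub>+\<^sub>1)\<close> with respect to \<open>(e\<^sub>1, e\<^sub>2)\<close>, for \<open>r = 3 m + 1\<close>, is invertible on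
  the line through \<open>(1, \<omega>, \<omega>\<^sup>2)\<close>, which is therefore a simple component of \<open>p\<^sub>r = p\<^sub>r\<^sub>+\<^sub>1 = 0\<close>.\<close>

lemma power_sum_in_e1_e2:
  fixes w :: complex
  assumes w: "w\<^sup>2 + w + 1 = 0"
  defines "ev \<equiv> eval3 1 w (w\<^sup>2)"
  shows "\<exists>A B A' B'. power_sum (3 * m + 1) = A * e1 + B * e2 \<and>
    power_sum (3 * m + 2) = A' * e1 + B' * e2 \<and>
    ev A = of_nat (3 * m + 1) \<and> ev B = 0 \<and> ev A' = 0 \<and> ev B' = - of_nat (3 * m + 2)"
proof (induction m)
  case 0
  have "power_sum 1 = 1 * e1 + 0 * e2" "power_sum 2 = e1 * e1 + (-2) * e2"
    by (simp_all add: power_sum_def e1_def e2_def algebra_simps power2_eq_square)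
  moreover have "ev 1 = 1" "ev 0 = 0" "ev e1 = 0" "ev (-2) = -2"
    using w by (simp_all add: ev_def e1_def algebra_simps)
  ultimately have "power_sum (3 * 0 + 1) = 1 * e1 + 0 * e2 \<and> power_sum (3 * 0 + 2) = e1 * e1 + (-2) * e2 \<and>
      ev 1 = of_nat (3 * 0 + 1) \<and> ev 0 = 0 \<and> ev e1 = 0 \<and> ev (-2) = - of_nat (3 * 0 + 2)"
    by (simp add: numeral_2_eq_2)
  thus ?case
    by blast
next
  case (Suc m)
  then obtain A B A' B' where IH: "power_sum (3 * m + 1) = A * e1 + B * e2"
    "power_sum (3 * m + 2) = A' * e1 + B' * e2" "ev A = of_nat (3 * m + 1)" "ev B = 0" "ev A' = 0"
    "ev B' = - of_nat (3 * m + 2)"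
    by blast
  have w3: "w ^ 3 = 1"
    using w by algebra
  have ev0: "ev e1 = 0" "ev e2 = 0" "ev e3 = 1"
    using w w3 by (simp_all add: ev_def e1_def e2_def e3_def power2_eq_square power3_eq_cube algebra_simps)
  have 3: "3 * m + 3 = 3 * (m + 1)"
    by simp
  have "w ^ (3 * m + 3) = 1"
    unfolding 3 power_mult w3 by simp
  moreover have "(w\<^sup>2) ^ (3 * m + 3) = (w ^ (3 * m + 3))\<^sup>2"
    by (simp only: mult.commute flip: power_mult)
  ultimately have ev3: "ev (power_sum (3 * m + 3)) = 3"
    unfolding ev_def eval3_power_sum by simp
  have ev2: "ev (power_sum (3 * m + 2)) = 0"
    unfolding IH(2) using ev0 by (simp add: ev_def)
  have rec: "power_sum d = e1 * power_sum c - e2 * power_sum b + e3 * power_sum a"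
    if "d = a + 3" "c = a + 2" "b = a + 1" for a b c d
    unfolding that by (rule power_sum_rec)
  have rec4: "power_sum (3 * m + 4) = e1 * power_sum (3 * m + 3) - e2 * power_sum (3 * m + 2)
      + e3 * power_sum (3 * m + 1)"
    by (rule rec) simp_all
  have rec5: "power_sum (3 * m + 5) = e1 * power_sum (3 * m + 4) - e2 * power_sum (3 * m + 3)
      + e3 * power_sum (3 * m + 2)"
    by (rule rec) simp_all
  have ev4: "ev (power_sum (3 * m + 4)) = 0"
    unfolding rec4 IH(1) using ev0 by (simp add: ev_def)
  \<comment> \<open>Insert the induction hypothesis into \<open>rec4\<close> and \<open>rec5\<close>
    and collect \<open>e1\<close> and \<open>e2\<close>. As \<open>ev e3 = 1\<close> and the power
    sum of exponent \<open>3 * m + 3\<close> evaluates to 3, the diagonal values change by 3 and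
    -3.\<close>
  define A1 B1 A2 B2 where "A1 = power_sum (3 * m + 3) + e3 * A"
    and "B1 = e3 * B - power_sum (3 * m + 2)"
    and "A2 = power_sum (3 * m + 4) + e3 * A'"
    and "B2 = e3 * B' - power_sum (3 * m + 3)"
  note defs = A1_def B1_def A2_def B2_def
  have "power_sum (3 * m + 4) = A1 * e1 + B1 * e2"
    unfolding rec4 IH(1) defs by (simp add: algebra_simps)
  moreover have "power_sum (3 * m + 5) = A2 * e1 + B2 * e2"
    unfolding rec5 IH(2) defs by (simp add: algebra_simps)
  moreover have "ev A1 = of_nat (3 * Suc m + 1)" "ev B1 = 0" "ev A2 = 0" "ev B2 = - of_nat (3 * Suc m + 2)"
    using IH ev0 ev2 ev3 ev4 by (simp_all add: defs ev_def)
  moreover have "3 * Suc m + 1 = 3 * m + 4" "3 * Suc m + 2 = 3 * m + 5"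
    by simp_all
  ultimately show ?case
    by metis
qed

text \<open>By Cramer's rule the determinant \<open>D\<close> multiplies \<open>e1\<close> and
  \<open>e2\<close>, hence also \<open>power_sum n\<close>, into the ideal of the first two.
  Regularity would put \<open>D\<close> itself there, but \<open>D\<close> does not vanish at the
  common zero.\<close>

lemma not_regular_sequence_if_common_zero:
  assumes m: "\<not> 3 dvd n"
  shows "\<not> regular_sequence [power_sum (3 * m + 1), power_sum (3 * m + 2), power_sum n]"
proof
  assume reg: "regular_sequence [power_sum (3 * m + 1), power_sum (3 * m + 2), power_sum n]"
  define w where "w = Complex (- 1 / 2) (sqrt 3 / 2)"
  have w: "w\<^sup>2 + w + 1 = 0"
    by (simp add: w_def complex_eq_iff power2_eq_square)
  define ev where "ev = eval3 1 w (w\<^sup>2)"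
  have ev0: "ev e1 = 0" "ev e2 = 0"
    using w unfolding ev_def e1_def e2_def eval3_simps by algebra+
  obtain A B A' B' where f: "power_sum (3 * m + 1) = A * e1 + B * e2"
    "power_sum (3 * m + 2) = A' * e1 + B' * e2"
    and ev: "ev A = of_nat (3 * m + 1)" "ev B = 0" "ev A' = 0" "ev B' = - of_nat (3 * m + 2)"
    using power_sum_in_e1_e2[OF w, of m] unfolding ev_def by blast
  have "\<exists>a b. power_sum n = a * e1 + b * e2"
  proof -
    have "n = 3 * (n div 3) + 1 \<or> n = 3 * (n div 3) + 2"
      using m by presburger
    thus ?thesis
      using power_sum_in_e1_e2[OF w, of "n div 3"] by metis
  qed
  then obtain a b where n: "power_sum n = a * e1 + b * e2"
    by blast
  define D where "D = A * B' - A' * B"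
  have "power_sum n * D = (a * B' - b * A') * power_sum (3 * m + 1) + (b * A - a * B) * power_sum (3 * m + 2)"
    unfolding n f D_def by (simp add: algebra_simps)
  hence "D \<in> ideal_generated {power_sum (3 * m + 1), power_sum (3 * m + 2)}"
    using reg unfolding regular_sequence_three ideal_generated_two by blast
  then obtain k l where "D = k * power_sum (3 * m + 1) + l * power_sum (3 * m + 2)"
    unfolding ideal_generated_two by blast
  hence "ev D = 0"
    unfolding f using ev0 by (simp add: ev_def)
  moreover have "ev D = ev A * ev B' - ev A' * ev B"
    by (simp add: D_def ev_def)
  hence "ev D = - of_nat ((3 * m + 1) * (3 * m + 2))"
    unfolding ev by (simp only: of_nat_mult mult_minus_right mult_zero_left diff_zero)
  ultimately show False
    by (simp only: neg_equal_0_iff_equal of_nat_eq_0_iff) simp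
qed

theorem corollary1p2:
  fixes r j :: nat
  assumes "r \<ge> 1" and "j \<in> {0, 1, 2, 3}"
  shows "regular_sequence [power_sum r, power_sum (r + 1), power_sum (3 * r + j)] \<longleftrightarrow>
         6 dvd r * (r + 1) * (3 * r + j)"
proof
  assume "6 dvd r * (r + 1) * (3 * r + j)"
  from common_zero_trivial[OF assms this, where z = 1]
  have "\<not> (a ^ r + b ^ r + 1 = 0 \<and> a ^ (r + 1) + b ^ (r + 1) + 1 = 0 \<and>
      a ^ (3 * r + j) + b ^ (3 * r + j) + 1 = 0)" for a b :: complex
    unfolding power_one by (metis zero_neq_one)
  thus "regular_sequence [power_sum r, power_sum (r + 1), power_sum (3 * r + j)]"
    using assms by (intro regular_sequence_if_no_common_zero) auto
next
  assume reg: "regular_sequence [power_sum r, power_sum (r + 1), power_sum (3 * r + j)]"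
  \<comment> \<open>The factor 2 is automatic from \<open>r * (r + 1)\<close>. If 3 divides neither
    \<open>r\<close> nor \<open>r + 1\<close>, then \<open>r\<close> is 1 modulo 3.\<close>
  have "3 dvd r * (r + 1) * (3 * r + j)"
  proof (rule ccontr)
    assume "\<not> ?thesis"
    hence not_dvd: "\<not> 3 dvd r" "\<not> 3 dvd r + 1" "\<not> 3 dvd 3 * r + j"
      by (metis dvd_mult dvd_mult2)+
    define m where "m = r div 3"
    have r: "r = 3 * m + 1" "r + 1 = 3 * m + 2"
      using not_dvd(1,2) unfolding m_def by presburger+
    show False
      using not_regular_sequence_if_common_zero[OF not_dvd(3), of m] reg r by metis
  qed
  moreover have "2 dvd r * (r + 1) * (3 * r + j)"
    by simp
  ultimately show "6 dvd r * (r + 1) * (3 * r + j)"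
    by presburger
qed

end
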